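(* Let $\mathcal{H}$ be a separable Hilbert space and suppose that $(F,G)=(\{f_k\}_{k=1}^\infty,\{g_k\}_{k=1}^\infty)$ is a biframe for $\mathcal{H}$ with biframe operator $S_{F,G}$. Then, for every $f\in\mathcal{H}$, the following reconstruction formula holds: $$f=\sum_{k=1}^\infty\langle f,S_{G,F}^{-1}f_k\rangle g_k=\sum_{k=1}^\infty\langle f,f_k\rangle S_{F,G}^{-1}g_k.$$ Moreover, in a complex Hilbert space, the first equation can be rewritten in the form $$f=\sum_{k=1}^\infty\langle f,S_{G,F}^{-1}f_k\rangle g_k=\sum_{k=1}^\infty\langle f,S_{F,G}^{-1}f_k\rangle g_k.$$
   Context: A pair $(F,G)=(\{f_k\}_{k=1}^\infty,\{g_k\}_{k=1}^\infty)$ of sequences in $\mathcal{H}$ is called a biframe for $\mathcal{H}$ if there exist positive constants $A$ and $B$ such that $A\|f\|^2\le\sum_{k=1}^\infty\langle f,f_k\rangle\langle g_k,f\rangle\le B\|f\|^2$ for all $f\in\mathcal{H}$; then $(G,F)$ is also a biframe. The biframe operators on $\mathcal{H}$ are $S_{F,G}f=\sum_{k=1}^\infty\langle f,f_k\rangle g_k$ and $S_{G,F}f=\sum_{k=1}^\infty\langle f,g_k\rangle f_k$. The inner product is linear in the first variable.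
   Formalization: The series defining the biframe operators S_{F,G} and S_{G,F} are assumed to converge in norm for every f in H; the biframe inequalities alone do not guarantee this, and without it the operators or the reconstruction series may fail to exist. *)

theory Defs
  imports "HOL-Analysis.Analysis"
begin

text \<open>
  Complex inner product spaces, the counterpart of \<^class>\<open>real_inner\<close>. The inner product is linear
  in the first argument. A complex Hilbert space is a type of sort
  \<open>{complex_inner, complete_space}\<close>, a real one a type of sort \<open>{real_inner, complete_space}\<close>.
\<close>

class complex_vector = real_vector +
  fixes scaleC :: "complex \<Rightarrow> 'a \<Rightarrow> 'a"
  assumes scaleC_add_right: "scaleC c (x + y) = scaleC c x + scaleC c y"
    and scaleC_add_left: "scaleC (c + d) x = scaleC c x + scaleC d x"
    and scaleC_scaleC: "scaleC c (scaleC d x) = scaleC (c * d) x"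
    and scaleC_of_real: "scaleC (complex_of_real r) x = scaleR r x"

class complex_inner = complex_vector + real_normed_vector +
  fixes cinner :: "'a \<Rightarrow> 'a \<Rightarrow> complex"
  assumes cinner_commute: "cinner x y = cnj (cinner y x)"
    and cinner_add_left: "cinner (x + y) z = cinner x z + cinner y z"
    and cinner_scaleC_left: "cinner (scaleC c x) y = c * cinner x y"
    and cinner_ge_zero: "0 \<le> Re (cinner x x)"
    and cinner_eq_zero_iff: "cinner x x = 0 \<longleftrightarrow> x = 0"
    and norm_eq_sqrt_cinner: "norm x = sqrt (Re (cinner x x))"

instantiation complex :: complex_inner
begin

definition "scaleC (c :: complex) (x :: complex) = c * x"
definition "cinner (x :: complex) (y :: complex) = x * cnj y"

instance
proof
  fix x y z c d :: complex and r :: real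
  show "scaleC c (x + y) = scaleC c x + scaleC c y"
    and "scaleC (c + d) x = scaleC c x + scaleC d x"
    and "scaleC c (scaleC d x) = scaleC (c * d) x"
    and "scaleC (complex_of_real r) x = r *\<^sub>R x"
    by (simp_all add: scaleC_complex_def algebra_simps scaleR_conv_of_real)
  show "cinner x y = cnj (cinner y x)"
    and "cinner (x + y) z = cinner x z + cinner y z"
    and "cinner (scaleC c x) y = c * cinner x y"
    and "0 \<le> Re (cinner x x)"
    and "cinner x x = 0 \<longleftrightarrow> x = 0"
    and "norm x = sqrt (Re (cinner x x))"
    by (simp_all add: scaleC_complex_def cinner_complex_def algebra_simps cmod_def power2_eq_square)
qed

end

text \<open>
  The notions below are parametrised by the scalar multiplication \<open>smul\<close> and the inner product
  \<open>ip\<close>, so that they can be used over both the real numbers (\<^const>\<open>scaleR\<close>, \<^const>\<open>inner\<close>) and the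
  complex numbers (\<^const>\<open>scaleC\<close>, \<^const>\<open>cinner\<close>). Sequences are indexed from 0, and series
  converge in the norm, in the given order of the terms.

  In a biframe the inequalities presuppose that the series converges to a real number, here \<open>s\<close>.
\<close>

definition biframe ::
  "('a \<Rightarrow> 'a \<Rightarrow> 'k::real_normed_field) \<Rightarrow> (nat \<Rightarrow> 'a::real_normed_vector) \<Rightarrow> (nat \<Rightarrow> 'a) \<Rightarrow> bool"
  where "biframe ip F G \<longleftrightarrow>
    (\<exists>A B. 0 < A \<and> 0 < B \<and>
      (\<forall>f. \<exists>s::real. (\<lambda>k. ip f (F k) * ip (G k) f) sums of_real s \<and>
        A * (norm f)\<^sup>2 \<le> s \<and> s \<le> B * (norm f)\<^sup>2))"

definition biframe_operator ::
  "('k \<Rightarrow> 'a \<Rightarrow> 'a) \<Rightarrow> ('a \<Rightarrow> 'a \<Rightarrow> 'k) \<Rightarrow>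
    (nat \<Rightarrow> 'a::real_normed_vector) \<Rightarrow> (nat \<Rightarrow> 'a) \<Rightarrow> 'a \<Rightarrow> 'a"
  where "biframe_operator smul ip F G f = (\<Sum>k. smul (ip f (F k)) (G k))"

text \<open>
  The defining series of a biframe operator has to converge at every vector for it to be an operator
  on the whole space. The biframe inequalities alone do not imply this: if
  \<open>e\<^sub>0, e\<^sub>1, \<dots>\<close> is an orthonormal basis, insert into both sequences of the biframe
  \<open>((e\<^sub>k), (e\<^sub>k))\<close> infinitely many consecutive pairs \<open>(e\<^sub>0, e\<^sub>n), (- e\<^sub>0, e\<^sub>n)\<close> with growing \<open>n\<close>.
\<close>

definition biframe_operator_defined ::
  "('k \<Rightarrow> 'a \<Rightarrow> 'a) \<Rightarrow> ('a \<Rightarrow> 'a \<Rightarrow> 'k) \<Rightarrow>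
    (nat \<Rightarrow> 'a::real_normed_vector) \<Rightarrow> (nat \<Rightarrow> 'a) \<Rightarrow> bool"
  where "biframe_operator_defined smul ip F G \<longleftrightarrow>
    (\<forall>f. summable (\<lambda>k. smul (ip f (F k)) (G k)))"

end

theory Submission
  imports Defs
begin

text \<open>
  Write \<open>T = S\<^bsub>F,G\<^esub>\<close> and \<open>U = S\<^bsub>G,F\<^esub>\<close>. Since \<open>U\<close> is an everywhere defined adjoint of \<open>T\<close> and
  \<open>\<langle>T f, f\<rangle> \<ge> A \<parallel>f\<parallel>\<^sup>2\<close>, the operator \<open>T\<close> is bounded below, so its range is closed (boundedness of
  \<open>T\<close> is not needed for this: a limit of \<open>T\<close> along a convergent sequence is identified by testing it
  against all vectors through \<open>U\<close>). A vector \<open>h\<close> orthogonal to the range satisfies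
  \<open>\<langle>T h, h\<rangle> = 0\<close>, hence vanishes, and \<open>T\<close> is bijective with bounded inverse. The two reconstruction
  formulas are \<open>f = T (T\<inverse> f)\<close>, with \<open>T\<inverse>\<close> moved to the other side of the inner products, and
  \<open>f = T\<inverse> (T f)\<close>. Over the complex numbers \<open>\<langle>T f, f\<rangle>\<close> is real, so \<open>T = U\<close> by polarization.
\<close>

section \<open>The Cauchy-Schwarz inequality\<close>

text \<open>Rescaling makes \<open>v\<close> and \<open>w\<close> equally long, and expanding the
  square of their difference gives the bound. The form \<open>b\<close> is abstract because the
  complex case needs the estimate for \<open>Re (cinner x y)\<close> before \<open>cinner\<close> is
  known to be bounded.\<close>

lemma bilinear_form_le_norm:
  fixes b :: "'a::real_normed_vector \<Rightarrow> 'a \<Rightarrow> real"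
  assumes add: "\<And>x y z. b (x + y) z = b x z + b y z"
    and scale: "\<And>r x y. b (r *\<^sub>R x) y = r * b x y"
    and commute: "\<And>x y. b x y = b y x"
    and norm: "\<And>x. (norm x)\<^sup>2 = b x x"
  shows "b x y \<le> norm x * norm y"
proof (cases "x = 0 \<or> y = 0")
  case True
  then show ?thesis
    using scale[of 0 0 y] scale[of 0 0 x] commute[of x 0] by auto
next
  case False
  define v w where "v = norm y *\<^sub>R x" and "w = norm x *\<^sub>R y"
  \<comment> \<open>The difference \<open>v - w\<close> is written as a sum with a scalar multiple,
    matching the assumed rules for \<open>b\<close>.\<close>
  have sum: "b (v + (- 1) *\<^sub>R w) (v + (- 1) *\<^sub>R w) = b v v - 2 * b v w + b w w"
    using add[of v "(- 1) *\<^sub>R w"] scale[of "- 1" w] commute[of v "v + (- 1) *\<^sub>R w"]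
      commute[of w "v + (- 1) *\<^sub>R w"] commute[of w v] by simp
  have "b v w = norm x * norm y * b x y"
    using scale[of "norm y" x w] scale[of "norm x" y x] commute[of x w] commute[of y x]
    by (simp add: v_def w_def)
  moreover have "b v v = (norm x * norm y)\<^sup>2" "b w w = (norm x * norm y)\<^sup>2"
    unfolding norm[symmetric] by (simp_all add: v_def w_def mult.commute)
  moreover have "0 \<le> b v v - 2 * b v w + b w w"
    using zero_le_power2[of "norm (v + (- 1) *\<^sub>R w)"] unfolding norm sum .
  ultimately have "(norm x * norm y) * b x y \<le> (norm x * norm y) * (norm x * norm y)"
    by (simp add: power2_eq_square algebra_simps)
  moreover have "0 < norm x * norm y"
    using False by simp
  ultimately show ?thesis
    by (metis mult_le_cancel_left_pos)
qed

text \<open>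
  Covers real Hilbert spaces with \<open>cj = re = (\<lambda>a. a)\<close> and complex ones with \<open>cj = cnj\<close>, \<open>re = Re\<close>.
\<close>
locale hilbert =
  fixes smul :: "'k::real_normed_field \<Rightarrow> 'a::{real_normed_vector, complete_space} \<Rightarrow> 'a"
    and ip :: "'a \<Rightarrow> 'a \<Rightarrow> 'k"
    and cj :: "'k \<Rightarrow> 'k"
    and re :: "'k \<Rightarrow> real"
  assumes bounded_linear_re: "bounded_linear re"
    and re_of_real: "re (of_real r) = r"
    and bounded_linear_cj: "bounded_linear cj"
    and cj_mult: "cj (a * b) = cj a * cj b"
    and cj_of_real: "cj (of_real r) = of_real r"
    and re_cj: "re (cj a) = re a"
    and bounded_bilinear_smul: "bounded_bilinear smul"
    and smul_smul: "smul a (smul b x) = smul (a * b) x"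
    and bounded_linear_ip: "bounded_linear (\<lambda>x. ip x y)"
    and ip_commute: "ip x y = cj (ip y x)"
    and ip_smul: "ip (smul a x) y = a * ip x y"
    and norm_sq: "(norm x)\<^sup>2 = re (ip x x)"
begin

section \<open>The underlying real inner product\<close>

text \<open>The real part of \<open>ip\<close> is a real inner product with the same norm, so
  projection and closed range arguments can be done once for both scalar fields.\<close>

definition rip :: "'a \<Rightarrow> 'a \<Rightarrow> real"
  where "rip x y = re (ip x y)"

lemma rip_commute: "rip x y = rip y x"
  unfolding rip_def by (metis ip_commute re_cj)

lemma bounded_linear_rip: "bounded_linear (\<lambda>x. rip x y)"
  unfolding rip_def using bounded_linear_compose[OF bounded_linear_re bounded_linear_ip] .

lemma rip_left:
  "rip (x + y) z = rip x z + rip y z"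
  "rip (x - y) z = rip x z - rip y z"
  "rip (r *\<^sub>R x) z = r * rip x z"
  using linear_simps(1,2,5)[OF bounded_linear_rip] by simp_all

lemma rip_right:
  "rip z (x + y) = rip z x + rip z y"
  "rip z (x - y) = rip z x - rip z y"
  "rip z (r *\<^sub>R x) = r * rip z x"
  using rip_left[of _ _ z] rip_commute[of z] by simp_all

lemma norm_sq_rip: "(norm x)\<^sup>2 = rip x x"
  unfolding rip_def by (rule norm_sq)

lemma rip_self_eq_zero: "rip x x = 0 \<longleftrightarrow> x = 0"
  using norm_sq_rip[of x] by auto

lemma rip_le_norm: "rip x y \<le> norm x * norm y"
  by (rule bilinear_form_le_norm) (fact rip_left rip_commute norm_sq_rip)+

section \<open>Projection onto closed subspaces\<close>

lemma parallelogram: "(norm (x + y))\<^sup>2 + (norm (x - y))\<^sup>2 = 2 * (norm x)\<^sup>2 + 2 * (norm y)\<^sup>2" for x y :: 'a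
  unfolding norm_sq_rip rip_left rip_right by (simp add: algebra_simps)

text \<open>A minimizing sequence is Cauchy: midpoints stay in \<open>S\<close>, hence at distance
  at least \<open>d\<close> from \<open>y\<close>, and the parallelogram law then bounds the
  differences.\<close>

lemma exists_nearest_point:
  fixes y :: 'a
  assumes "subspace S" "closed S"
  obtains s where "s \<in> S" "\<And>x. x \<in> S \<Longrightarrow> norm (y - s) \<le> norm (y - x)"
proof -
  have ne: "S \<noteq> {}"
    using subspace_0[OF assms(1)] by auto
  define d where "d = infdist y S"
  have d_le: "d \<le> norm (y - x)" if "x \<in> S" for x
    using infdist_le[OF that, of y] by (simp add: d_def dist_norm)
  have d0: "0 \<le> d"
    by (simp add: d_def infdist_nonneg)
  have "\<exists>x\<in>S. norm (y - x) < d + 1 / real (Suc n)" for n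
  proof (rule ccontr)
    assume "\<not> ?thesis"
    then have "d + 1 / real (Suc n) \<le> infdist y S"
      unfolding infdist_def using ne by (auto intro!: cINF_greatest simp: dist_norm not_less)
    then show False
      by (simp add: d_def)
  qed
  then obtain u where uS: "u n \<in> S" and u: "norm (y - u n) < d + 1 / real (Suc n)" for n
    by metis
  \<comment> \<open>Linear control of the squared excess over \<open>d\<close> suffices, since
    \<open>1 / (n + 1)\<close> dominates its own square.\<close>
  have sq: "(norm (y - u n))\<^sup>2 \<le> d\<^sup>2 + (2 * d + 1) / real (Suc n)" for n
  proof -
    have "(norm (y - u n))\<^sup>2 \<le> (d + 1 / real (Suc n))\<^sup>2"
      using u[of n] by (intro power_mono) auto
    also have "\<dots> = d\<^sup>2 + 2 * d / real (Suc n) + (1 / real (Suc n)) * (1 / real (Suc n))"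
      unfolding power2_sum by (simp add: power2_eq_square)
    also have "(1 / real (Suc n)) * (1 / real (Suc n)) \<le> 1 * (1 / real (Suc n))"
      by (intro mult_right_mono) auto
    finally show ?thesis
      by (simp add: add_divide_distrib)
  qed
  have diff: "(norm (u m - u n))\<^sup>2 \<le> 2 * (2 * d + 1) * (1 / real (Suc m) + 1 / real (Suc n))" for m n
  proof -
    define e where "e k = (2 * d + 1) / real (Suc k)" for k
    \<comment> \<open>The midpoint bounds the sum term of the parallelogram law below by
      \<open>(2 * d)\<close> squared, which cancels the \<open>d\<close> squared contributions of
      \<open>sq\<close>.\<close>
    have "(1 / 2) *\<^sub>R (u m + u n) \<in> S"
      using assms(1) uS by (simp add: subspace_add subspace_scale)
    then have "d \<le> norm (y - (1 / 2) *\<^sub>R (u m + u n))"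
      by (rule d_le)
    moreover have "(y - u m) + (y - u n) = 2 *\<^sub>R (y - (1 / 2) *\<^sub>R (u m + u n))"
      by (simp add: algebra_simps scaleR_2)
    ultimately have "2 * d \<le> norm ((y - u m) + (y - u n))"
      by simp
    then have "(2 * d)\<^sup>2 \<le> (norm ((y - u m) + (y - u n)))\<^sup>2"
      using d0 by (intro power_mono) auto
    moreover have "norm ((y - u m) - (y - u n)) = norm (u m - u n)"
      by (simp add: norm_minus_commute)
    ultimately have "(norm (u m - u n))\<^sup>2 \<le> 2 * (e m + e n)"
      using parallelogram[of "y - u m" "y - u n"] sq[of m, folded e_def] sq[of n, folded e_def]
      by (simp add: power_mult_distrib)
    also have "\<dots> = 2 * (2 * d + 1) * (1 / real (Suc m) + 1 / real (Suc n))"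
      by (simp add: e_def distrib_left)
    finally show ?thesis .
  qed
  have "Cauchy u"
  proof (rule metric_CauchyI)
    fix e :: real
    assume e: "0 < e"
    define K where "K = 2 * (2 * d + 1)"
    have K: "0 < K"
      using d0 by (simp add: K_def)
    \<comment> \<open>Each of the two reciprocals gets half of the budget
      \<open>e^2 / K\<close>.\<close>
    obtain N where N: "1 / real (Suc N) < e\<^sup>2 / (2 * K)"
      using e K reals_Archimedean[of "e\<^sup>2 / (2 * K)"] by (auto simp: inverse_eq_divide)
    have "dist (u m) (u n) < e" if "m \<ge> N" "n \<ge> N" for m n
    proof -
      have "1 / real (Suc m) \<le> 1 / real (Suc N)" "1 / real (Suc n) \<le> 1 / real (Suc N)"
        using that by (simp_all add: frac_le)
      then have "1 / real (Suc m) + 1 / real (Suc n) < e\<^sup>2 / K"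
        using N by simp
      then have "K * (1 / real (Suc m) + 1 / real (Suc n)) < e\<^sup>2"
        using K by (simp add: pos_less_divide_eq mult.commute)
      then have "(norm (u m - u n))\<^sup>2 < e\<^sup>2"
        using diff[of m n] by (simp add: K_def)
      then show ?thesis
        using e by (simp add: dist_norm power2_less_imp_less)
    qed
    then show "\<exists>M. \<forall>m\<ge>M. \<forall>n\<ge>M. dist (u m) (u n) < e"
      by blast
  qed
  then obtain s where s: "u \<longlonglongrightarrow> s"
    using Cauchy_convergent convergent_def by blast
  have "s \<in> S"
    using closed_sequentially[OF assms(2) uS s] .
  moreover have "norm (y - s) \<le> d"
  proof (rule LIMSEQ_le)
    show "(\<lambda>n. norm (y - u n)) \<longlonglongrightarrow> norm (y - s)"
      by (intro tendsto_intros s)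
    show "(\<lambda>n. d + 1 / real (Suc n)) \<longlonglongrightarrow> d"
      using tendsto_add[OF tendsto_const[of d] LIMSEQ_inverse_real_of_nat]
      by (simp add: inverse_eq_divide)
    show "\<exists>N. \<forall>n\<ge>N. norm (y - u n) \<le> d + 1 / real (Suc n)"
      using u less_imp_le by blast
  qed
  ultimately show thesis
    using that d_le order_trans by blast
qed

text \<open>Take \<open>h = y - s\<close> with \<open>y\<close> outside \<open>S\<close> and
  \<open>s\<close> its nearest point: a nonzero inner product with some \<open>x\<close> in
  \<open>S\<close> would allow moving \<open>s\<close> along \<open>x\<close> closer to
  \<open>y\<close>.\<close>

lemma exists_orthogonal:
  assumes "subspace S" "closed S" "S \<noteq> UNIV"
  obtains h where "h \<noteq> 0" "\<And>x. x \<in> S \<Longrightarrow> rip x h = 0"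
proof -
  obtain y where y: "y \<notin> S"
    using assms(3) by auto
  obtain s where s: "s \<in> S" and le: "\<And>x. x \<in> S \<Longrightarrow> norm (y - s) \<le> norm (y - x)"
    using exists_nearest_point[OF assms(1,2)] by metis
  have "rip x (y - s) = 0" if x: "x \<in> S" for x
  proof (cases "x = 0")
    case True
    then show ?thesis
      using rip_left(3)[of 0 0 "y - s"] by simp
  next
    case False
    \<comment> \<open>This \<open>t\<close> minimizes the squared norm of
      \<open>(y - s) - t *\<^sub>R x\<close>, lowering it by
      \<open>r^2 / (norm x)^2\<close>.\<close>
    define r t where "r = rip x (y - s)" and "t = r / (norm x)\<^sup>2"
    have "norm (y - s) \<le> norm (y - (s + t *\<^sub>R x))"
      using assms(1) s x by (intro le subspace_add subspace_scale)
    then have "(norm (y - s))\<^sup>2 \<le> (norm ((y - s) - t *\<^sub>R x))\<^sup>2"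
      by (intro power_mono) (simp_all add: diff_diff_eq)
    also have "\<dots> = (norm (y - s))\<^sup>2 - 2 * t * r + t * t * (norm x)\<^sup>2"
      unfolding norm_sq_rip r_def rip_left(2)[of "y - s"] rip_right(2)[of _ "y - s"]
        rip_left(3) rip_right(3) rip_commute[of "y - s" x]
      by (simp add: algebra_simps)
    also have "\<dots> = (norm (y - s))\<^sup>2 - r\<^sup>2 / (norm x)\<^sup>2"
      using False by (simp add: t_def field_simps power2_eq_square)
    finally have "r\<^sup>2 / (norm x)\<^sup>2 \<le> 0"
      by simp
    then show ?thesis
      using False by (simp add: r_def divide_le_0_iff)
  qed
  moreover have "y - s \<noteq> 0"
    using y s by auto
  ultimately show thesis
    using that by blast
qed

section \<open>Coercive operators with an adjoint\<close>

lemma coercive_norm_le: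
  assumes "\<And>f. A * (norm f)\<^sup>2 \<le> rip (T f) f"
  shows "A * norm f \<le> norm (T f)"
proof (cases "f = 0")
  case False
  have "A * norm f * norm f \<le> norm (T f) * norm f"
    using assms[of f] rip_le_norm[of "T f" f] by (simp add: power2_eq_square mult.assoc)
  then show ?thesis
    using False by simp
qed simp

text \<open>A Lax-Milgram type argument: the lower bound gives injectivity and, with the adjoint
  \<open>U\<close>, a closed range; coercivity leaves no nonzero vector orthogonal to that
  range.\<close>

lemma coercive_bij:
  assumes T: "linear T"
    and adj: "\<And>f h. rip (T f) h = rip f (U h)"
    and A: "0 < A" "\<And>f. A * (norm f)\<^sup>2 \<le> rip (T f) f"
  shows "bij T"
proof -
  note le = coercive_norm_le[of A T, OF A(2)]
  have diff: "A * norm (f - g) \<le> norm (T f - T g)" for f g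
    using le[of "f - g"] by (simp add: linear_diff[OF T])
  have "inj T"
  proof (rule injI)
    fix f g
    assume "T f = T g"
    then have "norm (f - g) \<le> 0"
      using diff[of f g] A(1) by (simp add: mult_le_0_iff)
    then show "f = g"
      by simp
  qed
  have closed: "closed (range T)"
    unfolding closed_sequential_limits
  proof (intro allI impI, elim conjE)
    fix x y
    assume x: "\<forall>n. x n \<in> range T" and lim: "x \<longlonglongrightarrow> y"
    define u where "u n = inv T (x n)" for n
    have u: "x n = T (u n)" for n
      using x by (simp add: u_def f_inv_into_f)
    \<comment> \<open>The lower bound transfers the Cauchy property from the images
      \<open>x n\<close> to their preimages.\<close>
    have "Cauchy u"
    proof (rule metric_CauchyI)
      fix e :: real
      assume "0 < e"
      then have "0 < A * e"
        using A(1) by simp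
      then obtain M where M: "\<forall>m\<ge>M. \<forall>n\<ge>M. dist (x m) (x n) < A * e"
        using metric_CauchyD[OF LIMSEQ_imp_Cauchy[OF lim]] by blast
      have "dist (u m) (u n) < e" if "m \<ge> M" "n \<ge> M" for m n
      proof -
        have "A * dist (u m) (u n) \<le> dist (x m) (x n)"
          using diff by (simp add: dist_norm u)
        also have "\<dots> < A * e"
          using M that by blast
        finally show ?thesis
          using A(1) by simp
      qed
      then show "\<exists>M. \<forall>m\<ge>M. \<forall>n\<ge>M. dist (u m) (u n) < e"
        by blast
    qed
    then obtain f where f: "u \<longlonglongrightarrow> f"
      using Cauchy_convergent convergent_def by blast
    \<comment> \<open>With \<open>T\<close> moved across as \<open>U h\<close>, only the convergence
      of \<open>u\<close> to \<open>f\<close> is involved.\<close>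
    have "rip y h = rip (T f) h" for h
    proof (rule LIMSEQ_unique)
      show "(\<lambda>n. rip (x n) h) \<longlonglongrightarrow> rip y h"
        using bounded_linear.tendsto[OF bounded_linear_rip lim] .
      show "(\<lambda>n. rip (x n) h) \<longlonglongrightarrow> rip (T f) h"
        unfolding u adj using bounded_linear.tendsto[OF bounded_linear_rip f] .
    qed
    then have "rip (y - T f) (y - T f) = 0"
      by (simp add: rip_left(2))
    then show "y \<in> range T"
      by (simp add: rip_self_eq_zero)
  qed
  have subspace: "subspace (range T)"
    using linear_subspace_image[OF T subspace_UNIV] .
  have "surj T"
  proof (rule ccontr)
    assume "\<not> surj T"
    then obtain h where "h \<noteq> 0" and h: "\<And>x. x \<in> range T \<Longrightarrow> rip x h = 0"
      using exists_orthogonal[OF subspace closed] by metis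
    then show False
      using A(1) A(2)[of h] h[of "T h"] by (simp add: mult_le_0_iff)
  qed
  with \<open>inj T\<close> show ?thesis
    by (simp add: bij_def)
qed

section \<open>Biframe operators as linear maps\<close>

lemma operator_sums:
  assumes "biframe_operator_defined smul ip P Q"
  shows "(\<lambda>k. smul (ip f (P k)) (Q k)) sums biframe_operator smul ip P Q f"
  using assms unfolding biframe_operator_defined_def biframe_operator_def by (simp add: summable_sums)

lemma operator_linear:
  assumes "biframe_operator_defined smul ip P Q"
  shows "linear (biframe_operator smul ip P Q)"
proof (rule linearI)
  interpret smul: bounded_bilinear smul
    by (rule bounded_bilinear_smul)
  note sums = operator_sums[OF assms]
  fix f h r
  have "ip (f + h) y = ip f y + ip h y" and scale: "ip (r *\<^sub>R f) y = r *\<^sub>R ip f y" for y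
    using linear_simps(1,5)[OF bounded_linear_ip] by simp_all
  then have "(\<lambda>k. smul (ip (f + h) (P k)) (Q k)) sums
      (biframe_operator smul ip P Q f + biframe_operator smul ip P Q h)"
    using sums_add[OF sums sums, of f h] by (simp add: smul.add_left)
  then show "biframe_operator smul ip P Q (f + h) =
      biframe_operator smul ip P Q f + biframe_operator smul ip P Q h"
    using sums sums_unique2 by blast
  have "(\<lambda>k. smul (ip (r *\<^sub>R f) (P k)) (Q k)) sums (r *\<^sub>R biframe_operator smul ip P Q f)"
    using sums_scaleR_right[OF sums, of r f] by (simp add: scale smul.scaleR_left)
  then show "biframe_operator smul ip P Q (r *\<^sub>R f) = r *\<^sub>R biframe_operator smul ip P Q f"
    using sums sums_unique2 by blast
qed

text \<open>Supplements real linearity: scalars of the full field must pass through the inverse in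
  \<open>inv_smul\<close> and through the operators in complex polarization.\<close>

lemma operator_smul:
  assumes "biframe_operator_defined smul ip P Q"
  shows "biframe_operator smul ip P Q (smul c f) = smul c (biframe_operator smul ip P Q f)"
proof -
  have "(\<lambda>k. smul (ip (smul c f) (P k)) (Q k)) sums smul c (biframe_operator smul ip P Q f)"
    using bounded_linear.sums[OF bounded_bilinear.bounded_linear_right[OF bounded_bilinear_smul]
        operator_sums[OF assms], of c f]
    by (simp add: ip_smul smul_smul)
  then show ?thesis
    using operator_sums[OF assms] sums_unique2 by blast
qed

text \<open>Continuity of \<open>ip\<close> in its first argument lets it act termwise. For
  \<open>h = f\<close> the series is the one in the definition of a biframe.\<close>

lemma ip_operator_sums:
  assumes "biframe_operator_defined smul ip P Q"
  shows "(\<lambda>k. ip f (P k) * ip (Q k) h) sums ip (biframe_operator smul ip P Q f) h"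
  using bounded_linear.sums[OF bounded_linear_ip operator_sums[OF assms], of f h]
  by (simp add: ip_smul)

section \<open>The two operators of a biframe and their inverses\<close>

context
  fixes F G :: "nat \<Rightarrow> 'a"
  assumes bf: "biframe ip F G"
    and def_FG: "biframe_operator_defined smul ip F G"
    and def_GF: "biframe_operator_defined smul ip G F"
begin

abbreviation "S_FG \<equiv> biframe_operator smul ip F G"
abbreviation "S_GF \<equiv> biframe_operator smul ip G F"

text \<open>Conjugating the series of \<open>ip (S_GF h) f\<close> term by term yields that of
  \<open>ip (S_FG f) h\<close>, and sums are unique.\<close>

lemma operator_adjoint: "ip (S_FG f) h = ip f (S_GF h)"
proof -
  have "(\<lambda>k. cj (ip h (G k) * ip (F k) f)) sums cj (ip (S_GF h) f)"
    using bounded_linear.sums[OF bounded_linear_cj ip_operator_sums[OF def_GF]] .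
  then have "(\<lambda>k. ip f (F k) * ip (G k) h) sums ip f (S_GF h)"
    by (simp add: cj_mult ip_commute[symmetric] mult.commute)
  then show ?thesis
    using ip_operator_sums[OF def_FG] sums_unique2 by blast
qed

text \<open>The biframe sum is real, so the conjugation that relates the two quadratic forms fixes
  it. The common value serves both coercivity of \<open>S_GF\<close> and the complex identity
  \<open>S_FG = S_GF\<close>.\<close>

lemma operator_self_real: "\<exists>s. ip (S_FG f) f = of_real s \<and> ip (S_GF f) f = of_real s"
proof -
  obtain s where "(\<lambda>k. ip f (F k) * ip (G k) f) sums of_real s"
    using bf unfolding biframe_def by metis
  then have s: "ip (S_FG f) f = of_real s"
    using ip_operator_sums[OF def_FG] sums_unique2 by blast
  then have "ip (S_GF f) f = of_real s"
    using ip_commute[of "S_GF f" f] by (simp add: operator_adjoint[symmetric] cj_of_real)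
  with s show ?thesis
    by blast
qed

text \<open>\<open>A\<close> is the lower biframe bound of \<open>(F, G)\<close>; it serves
  \<open>S_GF\<close> as well because the quadratic forms coincide.\<close>

lemma operator_coercive:
  "\<exists>A>0. \<forall>f. A * (norm f)\<^sup>2 \<le> rip (S_FG f) f \<and> A * (norm f)\<^sup>2 \<le> rip (S_GF f) f"
proof -
  obtain A where A: "0 < A"
    "\<And>f. \<exists>s::real. (\<lambda>k. ip f (F k) * ip (G k) f) sums of_real s \<and> A * (norm f)\<^sup>2 \<le> s"
    using bf unfolding biframe_def by metis
  have "A * (norm f)\<^sup>2 \<le> rip (S_FG f) f" for f
  proof -
    obtain s where s: "(\<lambda>k. ip f (F k) * ip (G k) f) sums of_real s" "A * (norm f)\<^sup>2 \<le> s"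
      using A(2) by blast
    then have "ip (S_FG f) f = of_real s"
      using ip_operator_sums[OF def_FG] sums_unique2 by blast
    with s(2) show ?thesis
      by (simp add: rip_def re_of_real)
  qed
  moreover have "rip (S_GF f) f = rip (S_FG f) f" for f
    using operator_self_real[of f] by (auto simp: rip_def)
  ultimately show ?thesis
    using A(1) by auto
qed

lemma bij_S_FG: "bij S_FG"
proof -
  obtain A where "0 < A" "\<And>f. A * (norm f)\<^sup>2 \<le> rip (S_FG f) f"
    using operator_coercive by blast
  then show ?thesis
    by (rule coercive_bij[OF operator_linear[OF def_FG], of S_GF, rotated])
      (simp add: rip_def operator_adjoint)
qed

lemma bij_S_GF: "bij S_GF"
proof -
  obtain A where "0 < A" "\<And>f. A * (norm f)\<^sup>2 \<le> rip (S_GF f) f"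
    using operator_coercive by blast
  moreover have "rip (S_GF f) h = rip f (S_FG h)" for f h
    unfolding rip_commute[of "S_GF f"] rip_commute[of f] by (simp add: rip_def operator_adjoint)
  ultimately show ?thesis
    using coercive_bij[OF operator_linear[OF def_GF], of S_FG] by blast
qed

text \<open>Adjointness evaluated at the two preimages. It moves the inverse from \<open>f\<close>
  onto the vectors \<open>F k\<close> in the coefficients.\<close>

lemma inv_adjoint: "ip (inv S_FG f) h = ip f (inv S_GF h)"
  using operator_adjoint[of "inv S_FG f" "inv S_GF h"] bij_S_FG bij_S_GF
  by (simp add: bij_is_surj surj_f_inv_f)

lemma inv_smul: "inv S_FG (smul c f) = smul c (inv S_FG f)"
  using bij_S_FG
  by (intro inv_f_eq) (simp_all add: operator_smul[OF def_FG] bij_is_inj bij_is_surj surj_f_inv_f)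

text \<open>The lower bound at \<open>inv S_FG f\<close> gives norm at most \<open>1 / A\<close>.
  Continuity is what allows the inverse to act termwise on a series.\<close>

lemma bounded_linear_inv: "bounded_linear (inv S_FG)"
proof -
  obtain A where A: "0 < A" "\<And>f. A * (norm f)\<^sup>2 \<le> rip (S_FG f) f"
    using operator_coercive by blast
  have S: "S_FG (inv S_FG f) = f" for f
    using bij_S_FG by (simp add: bij_is_surj surj_f_inv_f)
  note T = operator_linear[OF def_FG]
  show ?thesis
  proof (rule bounded_linear_intro[of _ "1 / A"])
    show "inv S_FG (f + h) = inv S_FG f + inv S_FG h" for f h
      by (rule inv_f_eq[OF bij_is_inj[OF bij_S_FG]]) (simp add: linear_add[OF T] S)
    show "inv S_FG (r *\<^sub>R f) = r *\<^sub>R inv S_FG f" for r f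
      by (rule inv_f_eq[OF bij_is_inj[OF bij_S_FG]]) (simp add: linear_scale[OF T] S)
    show "norm (inv S_FG f) \<le> norm f * (1 / A)" for f
      using coercive_norm_le[of A S_FG "inv S_FG f", OF A(2)] A(1) by (simp add: S field_simps)
  qed
qed

text \<open>This is the series of \<open>S_FG\<close> at \<open>inv S_FG f\<close>.\<close>

lemma reconstruction_dual: "(\<lambda>k. smul (ip f (inv S_GF (F k))) (G k)) sums f"
  using operator_sums[OF def_FG, of "inv S_FG f"] bij_S_FG
  by (simp add: inv_adjoint bij_is_surj surj_f_inv_f)

text \<open>Here the bounded inverse is applied termwise to the series of
  \<open>S_FG f\<close>.\<close>

lemma reconstruction_inv: "(\<lambda>k. smul (ip f (F k)) (inv S_FG (G k))) sums f"
  using bounded_linear.sums[OF bounded_linear_inv operator_sums[OF def_FG], of f] bij_S_FG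
  by (simp add: inv_smul bij_is_inj)

end

end

section \<open>Real and complex Hilbert spaces as instances\<close>

lemma hilbert_real:
  "hilbert scaleR (inner :: 'a::{real_inner, complete_space} \<Rightarrow> _) (\<lambda>a. a) (\<lambda>a. a)"
  by (rule hilbert.intro)
    (simp_all add: bounded_linear_ident bounded_bilinear_scaleR bounded_linear_inner_right
      inner_commute power2_norm_eq_inner)

lemma cinner_add_right: "cinner z (x + y) = cinner z x + cinner z y"
  by (metis cinner_add_left cinner_commute complex_cnj_add)

lemma cinner_scaleC_right: "cinner x (scaleC c y) = cnj c * cinner x y"
  by (metis cinner_commute cinner_scaleC_left complex_cnj_mult)

lemma cinner_scaleR_left: "cinner (r *\<^sub>R x) y = r *\<^sub>R cinner x y"
  by (metis cinner_scaleC_left scaleC_of_real scaleR_conv_of_real)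

lemma cinner_self: "cinner x x = of_real ((norm x)\<^sup>2)"
proof -
  have "Im (cinner x x) = 0"
    using arg_cong[OF cinner_commute[of x x], of Im] by simp
  then show ?thesis
    by (simp add: complex_eq_iff norm_eq_sqrt_cinner cinner_ge_zero)
qed

text \<open>The class postulates homogeneity of the norm for real scalars only; for complex ones it
  comes from \<open>cinner (scaleC c x) (scaleC c x)\<close>.\<close>

lemma norm_scaleC: "norm (scaleC c x) = norm c * norm (x :: 'a::complex_inner)"
proof -
  have "complex_of_real ((norm (scaleC c x))\<^sup>2) = (c * cnj c) * of_real ((norm x)\<^sup>2)"
    unfolding cinner_self[symmetric] cinner_scaleC_left cinner_scaleC_right by simp
  also have "\<dots> = of_real ((norm c * norm x)\<^sup>2)"
    by (simp add: complex_norm_square[symmetric] power_mult_distrib del: of_real_power)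
  finally show ?thesis
    by (simp only: of_real_eq_iff) (simp add: power2_eq_iff_nonneg)
qed

lemma Re_cinner_le: "Re (cinner x y) \<le> norm x * norm (y :: 'a::complex_inner)"
proof (rule bilinear_form_le_norm)
  show "Re (cinner (x + y) z) = Re (cinner x z) + Re (cinner y z)" for x y z :: 'a
    by (simp add: cinner_add_left)
  show "Re (cinner (r *\<^sub>R x) y) = r * Re (cinner x y)" for r and x y :: 'a
    by (simp add: cinner_scaleR_left)
  show "Re (cinner x y) = Re (cinner y x)" for x y :: 'a
    by (metis cinner_commute cnj.simps(1))
  show "(norm x)\<^sup>2 = Re (cinner x x)" for x :: 'a
    by (simp add: cinner_self)
qed

text \<open>Multiplying \<open>x\<close> by the conjugate phase \<open>c\<close> makes the inner
  product real and nonnegative without changing \<open>norm x\<close>, so the estimate for real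
  parts applies.\<close>

lemma norm_cinner_le: "norm (cinner x y) \<le> norm x * norm (y :: 'a::complex_inner)"
proof (cases "cinner x y = 0")
  case False
  define c where "c = cnj (sgn (cinner x y))"
  have "c * cinner x y = of_real ((norm (cinner x y))\<^sup>2) / of_real (norm (cinner x y))"
    unfolding complex_norm_square by (simp add: c_def sgn_eq)
  also have "\<dots> = of_real (norm (cinner x y))"
    by (simp add: power2_eq_square)
  finally have "norm (cinner x y) = Re (cinner (scaleC c x) y)"
    by (simp add: cinner_scaleC_left)
  also have "\<dots> \<le> norm (scaleC c x) * norm y"
    by (rule Re_cinner_le)
  also have "norm (scaleC c x) = norm x"
    using False by (simp add: norm_scaleC c_def norm_sgn)
  finally show ?thesis .
qed simp

lemma bounded_bilinear_scaleC: "bounded_bilinear (scaleC :: complex \<Rightarrow> 'a::complex_inner \<Rightarrow> 'a)"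
proof
  show "\<exists>K. \<forall>a b. norm (scaleC a (b :: 'a)) \<le> norm a * norm b * K"
    by (rule exI[of _ 1]) (simp add: norm_scaleC)
qed (simp_all add: scaleC_add_left scaleC_add_right scaleR_conv_of_real
    scaleC_of_real[symmetric] scaleC_scaleC mult.commute)

lemma hilbert_complex:
  "hilbert scaleC (cinner :: 'a::{complex_inner, complete_space} \<Rightarrow> _) cnj Re"
proof (rule hilbert.intro)
  show "bounded_linear (\<lambda>x. cinner x (y :: 'a))" for y
    using norm_cinner_le
    by (intro bounded_linear_intro[of _ "norm y"]) (simp_all add: cinner_add_left cinner_scaleR_left)
  show "cinner x y = cnj (cinner y x)" for x y :: 'a
    by (rule cinner_commute)
qed (simp_all add: bounded_linear_Re bounded_linear_cnj bounded_bilinear_scaleC scaleC_scaleC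
    cinner_scaleC_left cinner_self)

section \<open>Complex polarization\<close>

text \<open>Expanding at \<open>x + y\<close> and at \<open>x + scaleC \<i> y\<close> gives two
  equations that force \<open>cinner (D x) y = 0\<close>; then take \<open>y = D x\<close>. The real
  analogue fails for a quarter turn of the plane.\<close>

lemma cinner_quadratic_zero:
  fixes D :: "'a::complex_inner \<Rightarrow> 'a"
  assumes add: "\<And>x y. D (x + y) = D x + D y"
    and scale: "\<And>c x. D (scaleC c x) = scaleC c (D x)"
    and zero: "\<And>x. cinner (D x) x = 0"
  shows "D x = 0"
proof -
  have "cinner (D x) y = 0" for y
  proof -
    have "cinner (D x) y + cinner (D y) x = 0"
      using zero[of "x + y"] by (simp add: add cinner_add_left cinner_add_right zero add.commute)
    moreover have "- \<i> * cinner (D x) y + \<i> * cinner (D y) x = 0"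
      using zero[of "x + scaleC \<i> y"] zero[of y]
      by (simp add: add scale cinner_add_left cinner_add_right cinner_scaleC_left cinner_scaleC_right zero)
    ultimately show ?thesis
      by (simp add: algebra_simps complex_eq_iff)
  qed
  then show ?thesis
    using cinner_eq_zero_iff by blast
qed

text \<open>Both quadratic forms take the same real value, so that of the difference vanishes. With
  adjointness this says that the biframe operator is self-adjoint.\<close>

lemma complex_biframe_operator_commute:
  fixes F G :: "nat \<Rightarrow> 'a::{complex_inner, complete_space}"
  assumes "biframe cinner F G"
    "biframe_operator_defined scaleC cinner F G" "biframe_operator_defined scaleC cinner G F"
  shows "biframe_operator scaleC cinner F G = biframe_operator scaleC cinner G F"
proof
  fix f
  interpret hilbert scaleC "cinner :: 'a \<Rightarrow> _" cnj Re
    by (rule hilbert_complex)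
  interpret scaleC: bounded_bilinear "scaleC :: complex \<Rightarrow> 'a \<Rightarrow> 'a"
    by (rule bounded_bilinear_scaleC)
  let ?T = "biframe_operator scaleC cinner F G"
  let ?U = "biframe_operator scaleC cinner G F"
  have "?T f - ?U f = 0"
  proof (rule cinner_quadratic_zero[of "\<lambda>f. ?T f - ?U f"])
    show "?T (x + y) - ?U (x + y) = ?T x - ?U x + (?T y - ?U y)" for x y
      by (simp add: linear_add[OF operator_linear] assms)
    show "?T (scaleC c x) - ?U (scaleC c x) = scaleC c (?T x - ?U x)" for c x
      by (simp add: operator_smul assms scaleC.diff_right)
    show "cinner (?T x - ?U x) x = 0" for x
      using operator_self_real[OF assms, of x] linear_simps(2)[OF bounded_linear_ip] by auto
  qed
  then show "?T f = ?U f"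
    by simp
qed

section \<open>Reconstruction over both scalar fields\<close>

text \<open>Bijectivity is part of the conclusion because \<open>inv\<close> is a genuine inverse
  only then.\<close>

theorem theorem4p4:
  fixes F G :: "nat \<Rightarrow> 'a::{real_inner, complete_space}"
    and F' G' :: "nat \<Rightarrow> 'b::{complex_inner, complete_space}"
  shows
    "(separable_space (euclidean :: 'a topology) \<and>
      biframe inner F G \<and>
      biframe_operator_defined scaleR inner F G \<and>
      biframe_operator_defined scaleR inner G F \<longrightarrow>
        bij (biframe_operator scaleR inner F G) \<and>
        bij (biframe_operator scaleR inner G F) \<and>
        (\<forall>f. (\<lambda>k. inner f (inv (biframe_operator scaleR inner G F) (F k)) *\<^sub>R G k) sums f \<and>
             (\<lambda>k. inner f (F k) *\<^sub>R inv (biframe_operator scaleR inner F G) (G k)) sums f))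
     \<and>
     (separable_space (euclidean :: 'b topology) \<and>
      biframe cinner F' G' \<and>
      biframe_operator_defined scaleC cinner F' G' \<and>
      biframe_operator_defined scaleC cinner G' F' \<longrightarrow>
        bij (biframe_operator scaleC cinner F' G') \<and>
        bij (biframe_operator scaleC cinner G' F') \<and>
        (\<forall>f. (\<lambda>k. scaleC (cinner f (inv (biframe_operator scaleC cinner G' F') (F' k))) (G' k)) sums f \<and>
             (\<lambda>k. scaleC (cinner f (F' k)) (inv (biframe_operator scaleC cinner F' G') (G' k))) sums f \<and>
             (\<lambda>k. scaleC (cinner f (inv (biframe_operator scaleC cinner F' G') (F' k))) (G' k)) sums f))"
proof (intro conjI impI allI; elim conjE)
  note real = hilbert.bij_S_FG[OF hilbert_real] hilbert.bij_S_GF[OF hilbert_real]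
    hilbert.reconstruction_dual[OF hilbert_real] hilbert.reconstruction_inv[OF hilbert_real]
  assume "biframe inner F G" "biframe_operator_defined scaleR inner F G"
    "biframe_operator_defined scaleR inner G F"
  note r = real[OF this]
  show "bij (biframe_operator scaleR inner F G)" "bij (biframe_operator scaleR inner G F)"
    by (fact r)+
  fix f
  show "(\<lambda>k. inner f (inv (biframe_operator scaleR inner G F) (F k)) *\<^sub>R G k) sums f"
    "(\<lambda>k. inner f (F k) *\<^sub>R inv (biframe_operator scaleR inner F G) (G k)) sums f"
    by (fact r)+
next
  note complex = hilbert.bij_S_FG[OF hilbert_complex] hilbert.bij_S_GF[OF hilbert_complex]
    hilbert.reconstruction_dual[OF hilbert_complex] hilbert.reconstruction_inv[OF hilbert_complex]
  assume c: "biframe cinner F' G'" "biframe_operator_defined scaleC cinner F' G'"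
    "biframe_operator_defined scaleC cinner G' F'"
  note r = complex[OF this]
  show "bij (biframe_operator scaleC cinner F' G')" "bij (biframe_operator scaleC cinner G' F')"
    by (fact r)+
  fix f
  show "(\<lambda>k. scaleC (cinner f (inv (biframe_operator scaleC cinner G' F') (F' k))) (G' k)) sums f"
    "(\<lambda>k. scaleC (cinner f (F' k)) (inv (biframe_operator scaleC cinner F' G') (G' k))) sums f"
    by (fact r)+
  show "(\<lambda>k. scaleC (cinner f (inv (biframe_operator scaleC cinner F' G') (F' k))) (G' k)) sums f"
    \<comment> \<open>Replacing \<open>S_FG\<close> by \<open>S_GF\<close> turns the goal into the
      first reconstruction formula.\<close>
    unfolding complex_biframe_operator_commute[OF c] by (fact r)
qed

end
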